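(* For any distinct prime numbers $p_1,p_2,p_3,p_4$ and natural numbers $n_1,n_2,n_3,n_4\ge 1$, $$Cl_2(\mathbb{Z}_{p_1^{n_1}p_2^{n_2}p_3^{n_3}p_4^{n_4}})\cong\begin{cases}Shu^8_{M}(G_2), & \text{if } p_1^{n_1}=2,\\ Shu^{16}_{2M}(G_2), & \text{if } p_1^{n_1}=4,\\ Shu^{32}_{(p_1^{n_1}-p_1^{n_1-1})M}(G_2), & \text{if } p_1=2,\ n_1\geq 3,\\ Shu^{16}_{(p_1^{n_1}-p_1^{n_1-1})M}(G_2), & \text{if } p_1,p_2,p_3,p_4\neq 2,\end{cases}$$ where $M=(p_2^{n_2}-p_2^{n_2-1})(p_3^{n_3}-p_3^{n_3-1})(p_4^{n_4}-p_4^{n_4-1})$ and $G_2$ is the simple graph with the $14$ vertices $a,b,c,d,e,f,g,h,i,j,k,l,m,n$ and the $25$ edges $$ab,\,bc,\,cd,\,ad,\,ac,\,bd,\,ae,\,be,\,af,\,df,\,bg,\,cg,\,ch,\,dh,\,ak,\,bl,\,cm,\,dn,\,ai,\,ci,\,bj,\,dj,\,eh,\,fg,\,ij.$$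
   Context: $\mathbb{Z}_N$ is the ring of integers modulo $N$. For a ring $R$ with identity, $Id(R)$ is the set of idempotents and $U(R)$ the set of units. $Cl_2(R)$ is the simple undirected graph with vertex set $\{(e,u): e\in Id(R)\setminus\{0\},\ u\in U(R)\}$, in which two distinct vertices $(e,u)$ and $(f,v)$ are adjacent if and only if $ef=fe=0$ or $uv=vu=1$. The $(t,n)$-shuriken graph: let $G$ be a simple graph and let $n,t$ be positive integers with $n-t$ even ($t\le n$ in all uses here). Add a new vertex $z\notin V(G)$ to $G$ and take $n$ copies of the resulting graph; $G'_i$ is the $i$-th copy, with vertex set $V(G'_i)=\{z_i\}\cup\{v_i: v\in V(G)\}$. Then $Shu^t_n(G)$ is the simple graph with vertex set $\bigcup_{i=1}^n V(G'_i)$ and edge set $$\{u_iv_j: uv\in E(G),\ i,j\in\{1,\dots,n\}\}\cup\{u_iv_i: u_i,v_i\in V(G'_i),\ u_i\ne v_i,\ i\in\{1,\dots,t\}\}\cup\left\{u_iv_{n+t+1-i}: u_i\in V(G'_i),\ v_{n+t+1-i}\in V(G'_{n+t+1-i}),\ i\in\{t+1,\dots,\tfrac{n+t}{2}\}\right\},$$ where in the last two sets $u$ and $v$ range over $V(G)\cup\{z\}$ (with $u=v$ allowed in the last set). *)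

theory Defs
  imports
    "HOL-Number_Theory.Residues"
    "HOL-Computational_Algebra.Primes"
    "Graph_Theory.Graph_Theory"
begin

text \<open>
  A simple undirected graph is a \<open>pair_pre_digraph\<close> whose arc relation is symmetric and
  irreflexive (locale \<open>pair_bidirected_digraph\<close>; \<open>pair_graph\<close> in the finite case): an edge
  \<open>uv\<close> is the pair of arcs \<open>(u, v)\<close> and \<open>(v, u)\<close>. Isomorphism is \<open>digraph_iso\<close>, which for
  such graphs is the usual notion:
\<close>

lemma digraph_iso_pair_iff:
  assumes G: "pair_wf_digraph G" and H: "pair_wf_digraph H"
  shows "digraph_iso (with_proj G) (with_proj H) \<longleftrightarrow>
    (\<exists>f. bij_betw f (pverts G) (pverts H) \<and>
      (\<forall>u\<in>pverts G. \<forall>v\<in>pverts G. (u, v) \<in> parcs G \<longleftrightarrow> (f u, f v) \<in> parcs H))"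
    (is "?L \<longleftrightarrow> ?R")
proof
  assume ?L
  then obtain h where h: "pre_digraph.digraph_isomorphism (with_proj G) h"
    and eq: "with_proj H = app_iso h (with_proj G)"
    by (auto simp: digraph_iso_def)
  have verts: "pverts H = iso_verts h ` pverts G" and arcs: "parcs H = iso_arcs h ` parcs G"
    and tail: "iso_tail h = fst" and head: "iso_head h = snd"
    using eq by (simp_all add: with_proj_def app_iso_def)
  have inj: "inj_on (iso_verts h) (pverts G)"
    and arc: "\<And>a. a \<in> parcs G \<Longrightarrow> iso_arcs h a = (iso_verts h (fst a), iso_verts h (snd a))"
    using h by (simp_all add: pre_digraph.digraph_isomorphism_def tail head prod_eq_iff)
  have "(u, v) \<in> parcs G \<longleftrightarrow> (iso_verts h u, iso_verts h v) \<in> parcs H"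
    if uv: "u \<in> pverts G" "v \<in> pverts G" for u v
  proof
    assume "(u, v) \<in> parcs G"
    then show "(iso_verts h u, iso_verts h v) \<in> parcs H"
      unfolding arcs using arc[of "(u, v)"] by force
  next
    assume "(iso_verts h u, iso_verts h v) \<in> parcs H"
    then obtain a where a: "a \<in> parcs G" "iso_arcs h a = (iso_verts h u, iso_verts h v)"
      unfolding arcs by force
    then have "fst a \<in> pverts G" "snd a \<in> pverts G"
      using G by (auto dest: pair_wf_digraph.arc_fst_in_verts pair_wf_digraph.arc_snd_in_verts)
    with a arc[of a] inj uv have "a = (u, v)"
      by (auto simp: prod_eq_iff dest: inj_onD)
    with a show "(u, v) \<in> parcs G" by simp
  qed
  moreover have "bij_betw (iso_verts h) (pverts G) (pverts H)"
    using inj verts by (simp add: bij_betw_def)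
  ultimately show ?R by blast
next
  assume ?R
  then obtain f where f: "bij_betw f (pverts G) (pverts H)"
    and adj: "\<And>u v. u \<in> pverts G \<Longrightarrow> v \<in> pverts G \<Longrightarrow>
      (u, v) \<in> parcs G \<longleftrightarrow> (f u, f v) \<in> parcs H"
    by blast
  have inj: "inj_on f (pverts G)" and im: "f ` pverts G = pverts H"
    using f by (auto simp: bij_betw_def)
  have sub: "parcs G \<subseteq> pverts G \<times> pverts G"
    using G by (auto dest: pair_wf_digraph.in_arcsD1 pair_wf_digraph.in_arcsD2)
  have subH: "parcs H \<subseteq> pverts H \<times> pverts H"
    using H by (auto dest: pair_wf_digraph.in_arcsD1 pair_wf_digraph.in_arcsD2)
  have injp: "inj_on (map_prod f f) (parcs G)"
    using map_prod_inj_on[OF inj inj] sub by (rule inj_on_subset)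
  have arcs: "map_prod f f ` parcs G = parcs H"
  proof
    show "map_prod f f ` parcs G \<subseteq> parcs H" using sub adj by auto
    show "parcs H \<subseteq> map_prod f f ` parcs G"
    proof
      fix b assume b: "b \<in> parcs H"
      then obtain u v where uv: "u \<in> pverts G" "v \<in> pverts G" "b = (f u, f v)"
        using subH im by (cases b) blast
      with b adj have "(u, v) \<in> parcs G" by blast
      with uv show "b \<in> map_prod f f ` parcs G" by force
    qed
  qed
  let ?h = "\<lparr>iso_verts = f, iso_arcs = map_prod f f, iso_head = snd, iso_tail = fst\<rparr>"
  have "pre_digraph.digraph_isomorphism (with_proj G) ?h"
    using inj injp G by (simp add: pre_digraph.digraph_isomorphism_def wf_digraph_wp_iff)
  moreover have "with_proj H = app_iso ?h (with_proj G)"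
    using im arcs by (simp add: with_proj_def app_iso_def)
  ultimately show ?L unfolding digraph_iso_def by blast
qed

definition idempotents :: "('a, 'b) ring_scheme \<Rightarrow> 'a set" where
  "idempotents R = {e \<in> carrier R. e \<otimes>\<^bsub>R\<^esub> e = e}"

definition clean_graph2 :: "('a, 'b) ring_scheme \<Rightarrow> ('a \<times> 'a) pair_pre_digraph" where
  "clean_graph2 R =
    (let V = (idempotents R - {\<zero>\<^bsub>R\<^esub>}) \<times> Units R in
     \<lparr> pverts = V,
       parcs = {((e, u), (f, v)) | e u f v.
         (e, u) \<in> V \<and> (f, v) \<in> V \<and> (e, u) \<noteq> (f, v) \<and>
         ((e \<otimes>\<^bsub>R\<^esub> f = \<zero>\<^bsub>R\<^esub> \<and> f \<otimes>\<^bsub>R\<^esub> e = \<zero>\<^bsub>R\<^esub>) \<or>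
          (u \<otimes>\<^bsub>R\<^esub> v = \<one>\<^bsub>R\<^esub> \<and> v \<otimes>\<^bsub>R\<^esub> u = \<one>\<^bsub>R\<^esub>))} \<rparr>)"

lemma pair_bidirected_digraph_clean_graph2: "pair_bidirected_digraph (clean_graph2 R)"
  by unfold_locales
    (auto simp: clean_graph2_def Let_def symmetric_def intro!: symI)

text \<open>
  The copy \<open>v\<^sub>i\<close> of \<open>v \<in> V(G)\<close> is \<open>(Some v, i)\<close>, and the copy \<open>z\<^sub>i\<close> of the new vertex is
  \<open>(None, i)\<close>. The definition is meant for \<open>1 \<le> t \<le> n\<close> with \<open>n - t\<close> even, so that the
  division below is exact and all indices lie in \<open>{1..n}\<close>. The last edge set lists each edge
  in one orientation only, hence \<open>mk_symmetric\<close>.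
\<close>

definition shuriken :: "nat \<Rightarrow> nat \<Rightarrow> 'a pair_pre_digraph \<Rightarrow> ('a option \<times> nat) pair_pre_digraph"
  where
  "shuriken t n G =
    (let V' = insert None (Some ` pverts G) in
     mk_symmetric (with_proj
       \<lparr> pverts = V' \<times> {1..n},
         parcs =
           {((Some u, i), (Some v, j)) | u v i j. (u, v) \<in> parcs G \<and> i \<in> {1..n} \<and> j \<in> {1..n}} \<union>
           {((u, i), (v, i)) | u v i. u \<in> V' \<and> v \<in> V' \<and> u \<noteq> v \<and> i \<in> {1..t}} \<union>
           {((u, i), (v, n + t + 1 - i)) | u v i.
              u \<in> V' \<and> v \<in> V' \<and> i \<in> {t + 1..(n + t) div 2}} \<rparr>))"

lemma pair_graph_shuriken:
  assumes G: "pair_graph G" and tn: "t \<le> n"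
  shows "pair_graph (shuriken t n G)"
proof -
  interpret G: pair_graph G by fact
  have fin: "finite (pverts (shuriken t n G))"
    by (simp add: shuriken_def Let_def)
  have sub: "parcs (shuriken t n G) \<subseteq> pverts (shuriken t n G) \<times> pverts (shuriken t n G)"
    using tn by (auto simp: shuriken_def Let_def parcs_mk_symmetric dest: G.in_arcsD1 G.in_arcsD2)
  have irr: "fst a \<noteq> snd a" if "a \<in> parcs (shuriken t n G)" for a
    using that by (auto simp: shuriken_def Let_def parcs_mk_symmetric dest: G.no_loops')
  have sym: "symmetric (with_proj (shuriken t n G))"
    unfolding shuriken_def Let_def by (rule symmetric_mk_symmetric)
  show ?thesis
    using fin sub irr sym finite_subset[OF sub]
    by unfold_locales auto
qed

datatype g2_vertex = Va | Vb | Vc | Vd | Ve | Vf | Vg | Vh | Vi | Vj | Vk | Vl | Vm | Vn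

definition graph_G2 :: "g2_vertex pair_pre_digraph" where
  "graph_G2 = mk_symmetric (with_proj
     \<lparr> pverts = {Va, Vb, Vc, Vd, Ve, Vf, Vg, Vh, Vi, Vj, Vk, Vl, Vm, Vn},
       parcs = {(Va, Vb), (Vb, Vc), (Vc, Vd), (Va, Vd), (Va, Vc), (Vb, Vd),
                (Va, Ve), (Vb, Ve), (Va, Vf), (Vd, Vf), (Vb, Vg), (Vc, Vg),
                (Vc, Vh), (Vd, Vh), (Va, Vk), (Vb, Vl), (Vc, Vm), (Vd, Vn),
                (Va, Vi), (Vc, Vi), (Vb, Vj), (Vd, Vj), (Ve, Vh), (Vf, Vg),
                (Vi, Vj)} \<rparr>)"

lemma pair_graph_G2: "pair_graph graph_G2"
proof -
  have "symmetric (with_proj graph_G2)"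
    unfolding graph_G2_def by (rule symmetric_mk_symmetric)
  moreover have "\<forall>a \<in> parcs graph_G2. fst a \<noteq> snd a"
    by (simp add: graph_G2_def parcs_mk_symmetric)
  moreover have "parcs graph_G2 \<subseteq> pverts graph_G2 \<times> pverts graph_G2"
    by (simp add: graph_G2_def parcs_mk_symmetric)
  moreover have "finite (pverts graph_G2)" "finite (parcs graph_G2)"
    by (simp_all add: graph_G2_def parcs_mk_symmetric)
  ultimately show ?thesis
    by unfold_locales auto
qed

lemma card_graph_G2: "card (pverts graph_G2) = 14" "card (parcs graph_G2) = 2 * 25"
  by (simp_all add: graph_G2_def parcs_mk_symmetric)

end

theory Submission
  imports Defs "HOL-Number_Theory.Prime_Powers"
begin

text \<open>
  Two vertices \<open>(e, u)\<close> and \<open>(f, v)\<close> of the clean graph of a commutative ring are related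
  through their idempotents (\<open>e f = 0\<close>) or through their units (\<open>v\<close> is the inverse of \<open>u\<close>), and
  these two conditions do not interact. A shuriken graph has the same shape: a vertex \<open>x\<^sub>i\<close> is
  related to \<open>y\<^sub>j\<close> through the base graph, whatever the copies \<open>i\<close> and \<open>j\<close> are, or
  because the copies are linked, whatever \<open>x\<close> and \<open>y\<close> are. The links pair each of the first \<open>t\<close>
  copies with itself and match the others in pairs. So the two graphs are isomorphic once the
  nonzero idempotents match the vertices of the base graph together with \<open>z\<close>, and the units match
  the copies (\<open>clean_graph2_iso_shuriken\<close>).

  Units: inversion is an involution, and every involution of a finite set can be transported to the
  map that fixes \<open>1, \<dots>, t\<close> and reverses \<open>t + 1, \<dots>, n\<close>, where \<open>t\<close> counts its fixed points
  (\<open>involution_numbering\<close>). Hence \<open>n\<close> is the number of units, and \<open>t\<close> the number of solutions of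
  \<open>u\<^sup>2 = 1\<close>.

  Idempotents: modulo a prime power the only idempotents are \<open>0\<close> and \<open>1\<close>, so by the Chinese
  remainder theorem an idempotent of \<open>\<int>\<^sub>N\<close> is determined by the set of the prime powers
  modulo which it is \<open>1\<close>, and every set occurs. Orthogonality is disjointness of these sets. For four prime
  powers, the full set (the idempotent \<open>1\<close>) meets every nonempty set and corresponds to \<open>z\<close>; the
  fourteen remaining nonempty sets, joined when disjoint, form the graph \<open>G\<^sub>2\<close>, whose vertices
  \<open>a, b, c, d\<close> are the singletons (\<open>arcs_graph_G2_iff_disjoint\<close>).

  It remains to count. The number of units is Euler's totient. The number of square roots of \<open>1\<close> is
  multiplicative, and it is \<open>2\<close> for a power of an odd prime, and \<open>1, 2, 4\<close> for
  \<open>2, 4\<close> and the higher powers of \<open>2\<close>.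
\<close>

section \<open>Involutions and the arcs of shuriken graphs\<close>

text \<open>
  The copy that is linked to the \<open>i\<close>-th copy in a shuriken graph.
\<close>

definition mirror :: "nat \<Rightarrow> nat \<Rightarrow> nat \<Rightarrow> nat" where
  "mirror t n i = (if i \<le> t then i else n + t + 1 - i)"

text \<open>
  An involution splits a finite set into its fixed points and two-element orbits. The fixed points
  get the numbers up to \<open>t\<close>; one element of each orbit gets a number in the lower half of the
  remaining interval, and its partner the reflected number in the upper half.
\<close>

lemma involution_numbering:
  fixes \<sigma> :: "'a \<Rightarrow> 'a"
  assumes fin: "finite U"
    and mem: "\<And>u. u \<in> U \<Longrightarrow> \<sigma> u \<in> U"
    and invol: "\<And>u. u \<in> U \<Longrightarrow> \<sigma> (\<sigma> u) = u"
  defines "t \<equiv> card {u \<in> U. \<sigma> u = u}" and "n \<equiv> card U"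
  obtains \<psi> where "bij_betw \<psi> U {1..n}"
    and "\<And>u. u \<in> U \<Longrightarrow> \<psi> (\<sigma> u) = mirror t n (\<psi> u)"
    and "t \<le> n" and "even (n - t)"
proof -
  define F where "F = {u \<in> U. \<sigma> u = u}"
  obtain g :: "'a \<Rightarrow> nat" where g: "inj_on g U"
    using fin finite_imp_inj_to_nat_seg by blast
  \<comment> \<open>An auxiliary injection into the naturals selects one element of each two-element orbit.\<close>
  define H where "H = {u \<in> U. g u < g (\<sigma> u)}"
  define s where "s = card H"
  have finFH: "finite F" "finite H" using fin by (auto simp: F_def H_def)
  have \<sigma>H: "\<sigma> ` H = {u \<in> U. g (\<sigma> u) < g u}"
  proof (intro equalityI subsetI)
    fix u assume "u \<in> {u \<in> U. g (\<sigma> u) < g u}"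
    then have "\<sigma> u \<in> H" "u = \<sigma> (\<sigma> u)" by (auto simp: H_def mem invol)
    then show "u \<in> \<sigma> ` H" by blast
  qed (auto simp: H_def mem invol)
  have split: "U = F \<union> H \<union> \<sigma> ` H"
  proof (intro equalityI subsetI)
    fix u assume u: "u \<in> U"
    consider "g u = g (\<sigma> u)" | "g u < g (\<sigma> u)" | "g (\<sigma> u) < g u" by linarith
    then show "u \<in> F \<union> H \<union> \<sigma> ` H"
      using u mem[OF u] g unfolding \<sigma>H by cases (auto simp: F_def H_def dest: inj_onD)
  qed (auto simp: F_def H_def mem)
  have disj: "F \<inter> H = {}" "F \<inter> \<sigma> ` H = {}" "H \<inter> \<sigma> ` H = {}"
    unfolding \<sigma>H by (auto simp: F_def H_def)
  have inj\<sigma>: "inj_on \<sigma> H" by (rule inj_on_inverseI[where g = \<sigma>]) (auto simp: H_def invol)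
  have n: "n = t + s + s"
  proof -
    have "n = card (F \<union> H) + card (\<sigma> ` H)"
      unfolding n_def by (subst split, rule card_Un_disjoint) (use finFH disj in auto)
    also have "card (F \<union> H) = t + s"
      unfolding t_def s_def F_def[symmetric] by (rule card_Un_disjoint) (use finFH disj in auto)
    finally show ?thesis by (simp add: card_image[OF inj\<sigma>] s_def)
  qed
  have "card F = card {1..t}" by (simp add: t_def F_def)
  then obtain a where a: "bij_betw a F {1..t}"
    using finFH finite_same_card_bij by blast
  have "card H = card {t + 1..t + s}" by (simp add: s_def)
  then obtain b where b: "bij_betw b H {t + 1..t + s}"
    using finFH finite_same_card_bij by blast
  define \<psi> where
    "\<psi> u = (if u \<in> F then a u else if u \<in> H then b u else n + t + 1 - b (\<sigma> u))" for u
  have bF: "bij_betw \<psi> F {1..t}"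
    using a by (rule iffD1[OF bij_betw_cong, rotated]) (simp add: \<psi>_def)
  have bH: "bij_betw \<psi> H {t + 1..t + s}"
    using b by (rule iffD1[OF bij_betw_cong, rotated]) (use disj in \<open>auto simp: \<psi>_def\<close>)
  have b\<sigma>: "bij_betw \<psi> (\<sigma> ` H) {t + s + 1..n}"
  proof -
    have 1: "bij_betw \<sigma> (\<sigma> ` H) H"
      using inj\<sigma> by (intro bij_betwI[where g = \<sigma>]) (auto simp: H_def invol mem)
    have 2: "bij_betw (\<lambda>i. n + t + 1 - i) {t + 1..t + s} {t + s + 1..n}"
      by (rule bij_betwI[where g = "\<lambda>i. n + t + 1 - i"]) (auto simp: n)
    have "bij_betw ((\<lambda>i. n + t + 1 - i) \<circ> (b \<circ> \<sigma>)) (\<sigma> ` H) {t + s + 1..n}"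
      by (rule bij_betw_trans[OF bij_betw_trans[OF 1 b] 2])
    then show ?thesis
      by (rule iffD1[OF bij_betw_cong, rotated]) (use disj in \<open>auto simp: \<psi>_def\<close>)
  qed
  have "bij_betw \<psi> (F \<union> H \<union> \<sigma> ` H) ({1..t} \<union> {t + 1..t + s} \<union> {t + s + 1..n})"
    by (intro bij_betw_combine bF bH b\<sigma>) auto
  moreover have "{1..t} \<union> {t + 1..t + s} \<union> {t + s + 1..n} = {1..n}" by (auto simp: n)
  ultimately have "bij_betw \<psi> U {1..n}" using split by simp
  moreover have "\<psi> (\<sigma> u) = mirror t n (\<psi> u)" if "u \<in> U" for u
  proof -
    have inH: "\<psi> v = b v \<and> b v \<in> {t + 1..t + s} \<and> \<psi> (\<sigma> v) = n + t + 1 - b v" if "v \<in> H" for v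
    proof -
      have "v \<notin> F" "\<sigma> v \<notin> F" "\<sigma> v \<notin> H" "\<sigma> (\<sigma> v) = v" "b v \<in> {t + 1..t + s}"
        using that disj bij_betwE[OF b] by (auto simp: H_def invol)
      then show ?thesis using that by (simp add: \<psi>_def)
    qed
    consider "u \<in> F" | "u \<in> H" | v where "v \<in> H" "u = \<sigma> v"
      using \<open>u \<in> U\<close> split by blast
    then show ?thesis
    proof cases
      case 1
      then show ?thesis using bij_betwE[OF bF] by (auto simp: mirror_def F_def)
    next
      case 2
      then show ?thesis using inH[OF 2] by (auto simp: mirror_def)
    next
      case 3
      moreover have "\<sigma> u = v" using 3 by (simp add: H_def invol)
      ultimately show ?thesis using inH[OF 3(1)] by (auto simp: mirror_def n)
    qed
  qed
  ultimately show ?thesis using that n by simp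
qed

lemma arcs_mk_symmetric_iff:
  "(a, b) \<in> parcs (mk_symmetric (with_proj \<lparr>pverts = V, parcs = E\<rparr>)) \<longleftrightarrow> (a, b) \<in> E \<or> (b, a) \<in> E"
  by (auto simp: parcs_mk_symmetric Bex_def)

text \<open>
  Since \<open>n - t\<close> is even, the reflection of \<open>t + 1, \<dots>, n\<close> has no midpoint. So a copy
  beyond the \<open>t\<close>-th is never linked to itself, and the first half of that interval together with
  the symmetric closure accounts for all the links between different copies.
\<close>

lemma arcs_shuriken_iff:
  assumes G: "pair_bidirected_digraph G" and tn: "t \<le> n" "even (n - t)"
    and i: "i \<in> {1..n}" and j: "j \<in> {1..n}"
    and x: "x \<in> insert None (Some ` pverts G)" and y: "y \<in> insert None (Some ` pverts G)"
  shows "((x, i), (y, j)) \<in> parcs (shuriken t n G) \<longleftrightarrow>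
    (\<exists>u v. x = Some u \<and> y = Some v \<and> (u, v) \<in> parcs G) \<or>
    ((x, i) \<noteq> (y, j) \<and> j = mirror t n i)" (is "?L \<longleftrightarrow> ?R")
proof -
  interpret G: pair_bidirected_digraph G by fact
  have sym: "(v, u) \<in> parcs G" if "(u, v) \<in> parcs G" for u v
    using that G.arcs_symmetric by blast
  obtain s where n: "n = t + s + s"
  proof -
    have "n = t + (n - t) div 2 + (n - t) div 2" using tn by presburger
    then show ?thesis by (rule that)
  qed
  have half: "(n + t) div 2 = t + s" using n by simp
  let ?V = "insert None (Some ` pverts G)"
  define base where
    "base \<longleftrightarrow> (\<exists>u v. x = Some u \<and> y = Some v \<and> (u, v) \<in> parcs G)"
  have base_sym: "base \<longleftrightarrow> (\<exists>u v. y = Some u \<and> x = Some v \<and> (u, v) \<in> parcs G)"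
    unfolding base_def using sym by blast
  have "?L \<longleftrightarrow> base \<or> (i = j \<and> x \<noteq> y \<and> i \<le> t) \<or>
      (t < i \<and> i \<le> t + s \<and> j = n + t + 1 - i) \<or> (t < j \<and> j \<le> t + s \<and> i = n + t + 1 - j)"
  proof -
    have 1: "((x, i), (y, j)) \<in> {((Some u, i), (Some v, j)) | u v i j.
        (u, v) \<in> parcs G \<and> i \<in> {1..n} \<and> j \<in> {1..n}} \<longleftrightarrow> base"
      unfolding base_def using i j by blast
    have 2: "((y, j), (x, i)) \<in> {((Some u, i), (Some v, j)) | u v i j.
        (u, v) \<in> parcs G \<and> i \<in> {1..n} \<and> j \<in> {1..n}} \<longleftrightarrow> base"
      unfolding base_sym using i j by blast
    have 3: "((x, i), (y, j)) \<in> {((u, i), (v, i)) | u v i.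
        u \<in> ?V \<and> v \<in> ?V \<and> u \<noteq> v \<and> i \<in> {1..t}} \<longleftrightarrow> i = j \<and> x \<noteq> y \<and> i \<le> t"
      and 4: "((y, j), (x, i)) \<in> {((u, i), (v, i)) | u v i.
        u \<in> ?V \<and> v \<in> ?V \<and> u \<noteq> v \<and> i \<in> {1..t}} \<longleftrightarrow> i = j \<and> x \<noteq> y \<and> i \<le> t"
      using i j x y by auto
    have 5: "((x, i), (y, j)) \<in> {((u, i), (v, n + t + 1 - i)) | u v i.
        u \<in> ?V \<and> v \<in> ?V \<and> i \<in> {t + 1..(n + t) div 2}} \<longleftrightarrow>
        t < i \<and> i \<le> t + s \<and> j = n + t + 1 - i"
      and 6: "((y, j), (x, i)) \<in> {((u, i), (v, n + t + 1 - i)) | u v i.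
        u \<in> ?V \<and> v \<in> ?V \<and> i \<in> {t + 1..(n + t) div 2}} \<longleftrightarrow>
        t < j \<and> j \<le> t + s \<and> i = n + t + 1 - j"
      unfolding half using x y by (auto simp: Suc_le_eq)
    show ?thesis
      unfolding shuriken_def Let_def arcs_mk_symmetric_iff Un_iff 1 2 3 4 5 6 by blast
  qed
  also have "\<dots> \<longleftrightarrow> base \<or> ((x, i) \<noteq> (y, j) \<and> j = mirror t n i)"
  proof (cases "i \<le> t")
    case True
    then have "\<not> (t < j \<and> i = n + t + 1 - j)" using i j n by auto
    then show ?thesis using True unfolding mirror_def by auto
  next
    case False
    moreover have "t < j \<and> j \<le> t + s \<and> i = n + t + 1 - j \<longleftrightarrow> t + s < i \<and> j = n + t + 1 - i"
      using i j n False by auto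
    moreover have "i \<noteq> n + t + 1 - i" using i n by presburger
    ultimately show ?thesis unfolding mirror_def by auto
  qed
  finally show ?thesis unfolding base_def .
qed

section \<open>From rings to shuriken graphs\<close>

text \<open>
  The isomorphism acts separately on the two components of a vertex. The value \<open>None\<close> stands for
  the vertex \<open>z\<close>; the condition on \<open>\<phi>\<close> makes the idempotent that is sent to it orthogonal to no
  nonzero idempotent, as befits a vertex that is isolated before the copies are linked.
\<close>

lemma clean_graph2_iso_shuriken:
  assumes R: "cring R" and fin: "finite (Units R)" and G: "pair_graph G"
    and \<phi>: "bij_betw \<phi> (idempotents R - {\<zero>\<^bsub>R\<^esub>}) (insert None (Some ` pverts G))"
    and orth: "\<And>e f. e \<in> idempotents R - {\<zero>\<^bsub>R\<^esub>} \<Longrightarrow> f \<in> idempotents R - {\<zero>\<^bsub>R\<^esub>} \<Longrightarrow>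
      e \<otimes>\<^bsub>R\<^esub> f = \<zero>\<^bsub>R\<^esub> \<longleftrightarrow> (\<exists>x y. \<phi> e = Some x \<and> \<phi> f = Some y \<and> (x, y) \<in> parcs G)"
  shows "digraph_iso (with_proj (clean_graph2 R))
    (with_proj (shuriken (card {u \<in> Units R. u \<otimes>\<^bsub>R\<^esub> u = \<one>\<^bsub>R\<^esub>}) (card (Units R)) G))"
proof -
  interpret cring R by fact
  interpret G: pair_graph G by fact
  let ?t = "card {u \<in> Units R. u \<otimes>\<^bsub>R\<^esub> u = \<one>\<^bsub>R\<^esub>}" and ?n = "card (Units R)"
  let ?I = "idempotents R - {\<zero>\<^bsub>R\<^esub>}" and ?V = "insert None (Some ` pverts G)"
  have inv_iff: "u \<otimes>\<^bsub>R\<^esub> v = \<one>\<^bsub>R\<^esub> \<longleftrightarrow> v = inv\<^bsub>R\<^esub> u" if "u \<in> Units R" "v \<in> Units R" for u v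
    using that by (metis Units_closed Units_r_inv comm_inv_char)
  have fixed: "{u \<in> Units R. inv\<^bsub>R\<^esub> u = u} = {u \<in> Units R. u \<otimes>\<^bsub>R\<^esub> u = \<one>\<^bsub>R\<^esub>}"
    using inv_iff by auto
  obtain \<psi> where \<psi>: "bij_betw \<psi> (Units R) {1..?n}"
    and \<psi>inv: "\<And>u. u \<in> Units R \<Longrightarrow> \<psi> (inv\<^bsub>R\<^esub> u) = mirror ?t ?n (\<psi> u)"
    and tn: "?t \<le> ?n" "even (?n - ?t)"
    using involution_numbering[of "Units R" "m_inv R"] fin fixed by auto
  have unit: "u \<otimes>\<^bsub>R\<^esub> v = \<one>\<^bsub>R\<^esub> \<longleftrightarrow> \<psi> v = mirror ?t ?n (\<psi> u)"
    if "u \<in> Units R" "v \<in> Units R" for u v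
    using inv_iff[OF that] \<psi>inv[OF that(1)] Units_inv_Units[OF that(1)] that(2)
      inj_on_eq_iff[OF bij_betw_imp_inj_on[OF \<psi>]] by metis
  have verts: "pverts (clean_graph2 R) = ?I \<times> Units R"
    by (simp add: clean_graph2_def Let_def)
  have vertsS: "pverts (shuriken ?t ?n G) = ?V \<times> {1..?n}"
    by (simp add: shuriken_def Let_def)
  have bij: "bij_betw (map_prod \<phi> \<psi>) (?I \<times> Units R) (?V \<times> {1..?n})"
    by (rule bij_betw_map_prod[OF \<phi> \<psi>])
  interpret C: pair_bidirected_digraph "clean_graph2 R"
    by (rule pair_bidirected_digraph_clean_graph2)
  interpret S: pair_graph "shuriken ?t ?n G"
    by (rule pair_graph_shuriken[OF G tn(1)])
  have "((e, u), (f, v)) \<in> parcs (clean_graph2 R) \<longleftrightarrow>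
    ((\<phi> e, \<psi> u), (\<phi> f, \<psi> v)) \<in> parcs (shuriken ?t ?n G)"
    if e: "e \<in> ?I" and f: "f \<in> ?I" and u: "u \<in> Units R" and v: "v \<in> Units R" for e u f v
  proof -
    have comm: "f \<otimes>\<^bsub>R\<^esub> e = e \<otimes>\<^bsub>R\<^esub> f" "v \<otimes>\<^bsub>R\<^esub> u = u \<otimes>\<^bsub>R\<^esub> v"
      using e f u v by (auto simp: idempotents_def m_comm Units_closed)
    have ne: "(e, u) = (f, v) \<longleftrightarrow> (\<phi> e, \<psi> u) = (\<phi> f, \<psi> v)"
      using e f u v \<phi> \<psi> by (auto simp: bij_betw_def dest: inj_onD)
    have img: "\<phi> e \<in> ?V" "\<phi> f \<in> ?V" "\<psi> u \<in> {1..?n}" "\<psi> v \<in> {1..?n}"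
      using e f u v bij_betwE[OF \<phi>] bij_betwE[OF \<psi>] by blast+
    have "((e, u), (f, v)) \<in> parcs (clean_graph2 R) \<longleftrightarrow>
        (e, u) \<noteq> (f, v) \<and> (e \<otimes>\<^bsub>R\<^esub> f = \<zero>\<^bsub>R\<^esub> \<or> u \<otimes>\<^bsub>R\<^esub> v = \<one>\<^bsub>R\<^esub>)"
      using e f u v comm by (simp add: clean_graph2_def Let_def)
    \<comment> \<open>Nonzero orthogonal idempotents differ, so distinctness only matters for inverse units.\<close>
    also have "\<dots> \<longleftrightarrow> e \<otimes>\<^bsub>R\<^esub> f = \<zero>\<^bsub>R\<^esub> \<or> ((e, u) \<noteq> (f, v) \<and> u \<otimes>\<^bsub>R\<^esub> v = \<one>\<^bsub>R\<^esub>)"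
      using e by (auto simp: idempotents_def)
    also have "\<dots> \<longleftrightarrow> ((\<phi> e, \<psi> u), (\<phi> f, \<psi> v)) \<in> parcs (shuriken ?t ?n G)"
      unfolding arcs_shuriken_iff[OF G.pair_bidirected_digraph_axioms tn img(3,4,1,2)]
        orth[OF e f] unit[OF u v] ne by (rule refl)
    finally show ?thesis .
  qed
  then have "\<forall>a\<in>?I \<times> Units R. \<forall>b\<in>?I \<times> Units R. (a, b) \<in> parcs (clean_graph2 R) \<longleftrightarrow>
    (map_prod \<phi> \<psi> a, map_prod \<phi> \<psi> b) \<in> parcs (shuriken ?t ?n G)"
    by (clarsimp simp only: map_prod_simp) blast
  then show ?thesis
    unfolding digraph_iso_pair_iff[OF C.pair_wf_digraph_axioms S.pair_wf_digraph_axioms]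
      verts vertsS using bij by blast
qed

section \<open>Idempotents modulo a product of prime powers\<close>

text \<open>
  Only one of two coprime factors can be divisible by \<open>p\<close>. Applied to \<open>e (e - 1)\<close> this gives the
  idempotents modulo a prime power, and applied to \<open>y (y + 1)\<close> the square roots of \<open>1\<close> modulo a
  power of \<open>2\<close>.
\<close>

lemma prime_power_dvd_coprime_mult:
  fixes p a b :: int
  assumes "prime p" "coprime a b" "p ^ k dvd a * b"
  shows "p ^ k dvd a \<or> p ^ k dvd b"
proof (cases "p dvd a")
  case True
  then have "coprime (p ^ k) b"
    using assms(1,2) by (metis coprime_common_divisor coprime_power_left_iff not_prime_unit prime_imp_coprime)
  then show ?thesis using assms(3) by (simp add: coprime_dvd_mult_left_iff)
next
  case False
  then have "coprime (p ^ k) a"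
    using assms(1) by (simp add: prime_imp_coprime)
  then show ?thesis using assms(3) by (simp add: coprime_dvd_mult_right_iff)
qed

lemma idempotent_mod_primepow:
  fixes e q :: nat
  assumes "primepow q" "[e * e = e] (mod q)"
  shows "[e = 0] (mod q) \<or> [e = 1] (mod q)"
proof -
  obtain p k where p: "prime p" and q: "q = p ^ k"
    using assms(1) by (auto simp: primepow_def)
  have "int q dvd int (e * e) - int e"
    using assms(2) by (metis cong_iff_dvd_diff cong_int_iff)
  then have "int p ^ k dvd int e * (int e - 1)" by (simp add: q algebra_simps)
  moreover have "coprime (int e) (int e - 1)" by simp
  ultimately have "int p ^ k dvd int e \<or> int p ^ k dvd int e - 1"
    using p by (intro prime_power_dvd_coprime_mult) auto
  then have "[int e = int 0] (mod int q) \<or> [int e = int 1] (mod int q)"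
    by (simp add: q cong_iff_dvd_diff)
  then show ?thesis unfolding cong_int_iff .
qed

text \<open>
  For an idempotent \<open>e\<close>, being nonzero modulo the prime power \<open>q i\<close> is the same as being \<open>1\<close>
  modulo it.
\<close>

definition idem_support :: "('i \<Rightarrow> nat) \<Rightarrow> 'i set \<Rightarrow> nat \<Rightarrow> 'i set" where
  "idem_support q A e = {i \<in> A. \<not> q i dvd e}"

context
  fixes q :: "'i \<Rightarrow> nat" and A :: "'i set"
  assumes fin: "finite A" and pp: "\<And>i. i \<in> A \<Longrightarrow> primepow (q i)"
    and cop: "\<And>i j. i \<in> A \<Longrightarrow> j \<in> A \<Longrightarrow> i \<noteq> j \<Longrightarrow> coprime (q i) (q j)"
begin

lemma cong_support:
  assumes "[e * e = e] (mod (\<Prod>i\<in>A. q i))" "i \<in> A"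
  shows "[e = (if i \<in> idem_support q A e then 1 else 0)] (mod q i)"
proof -
  have "[e * e = e] (mod q i)"
    using assms fin by (metis cong_dvd_modulus_nat dvd_prodI)
  then show ?thesis
    using idempotent_mod_primepow[OF pp[OF assms(2)]] assms(2)
    by (auto simp: idem_support_def cong_0_iff)
qed

text \<open>
  By the Chinese remainder theorem the residues \<open>0\<close> and \<open>1\<close> modulo the factors can be prescribed
  independently, and they determine the number below the product.
\<close>

lemma bij_betw_idem_support:
  "bij_betw (idem_support q A) {e. e < (\<Prod>i\<in>A. q i) \<and> [e * e = e] (mod (\<Prod>i\<in>A. q i))} (Pow A)"
proof -
  let ?N = "\<Prod>i\<in>A. q i"
  have crt: "\<exists>!x. x < ?N \<and> (\<forall>i\<in>A. [x = (if i \<in> S then 1 else 0)] (mod q i))" for S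
    using fin cop pp by (intro chinese_remainder_unique_nat) (auto simp: primepow_gt_0_nat)
  have "inj_on (idem_support q A) {e. e < ?N \<and> [e * e = e] (mod ?N)}"
  proof (rule inj_onI; clarify)
    fix e f
    assume "e < ?N" "[e * e = e] (mod ?N)" "f < ?N" "[f * f = f] (mod ?N)"
      and "idem_support q A e = idem_support q A f"
    then show "e = f"
      using crt[of "idem_support q A e"] cong_support[of e] cong_support[of f] by auto
  qed
  moreover have "S \<in> idem_support q A ` {e. e < ?N \<and> [e * e = e] (mod ?N)}" if "S \<subseteq> A" for S
  proof -
    obtain e where e: "e < ?N" "\<And>i. i \<in> A \<Longrightarrow> [e = (if i \<in> S then 1 else 0)] (mod q i)"
      using crt[of S] by blast
    have "[e * e = e] (mod q i)" if "i \<in> A" for i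
    proof -
      let ?b = "if i \<in> S then 1 else 0 :: nat"
      have "[e * e = ?b * ?b] (mod q i)" by (intro cong_mult e that)
      also have "?b * ?b = ?b" by simp
      also have "[?b = e] (mod q i)" using e(2)[OF that] by (rule cong_sym)
      finally show ?thesis .
    qed
    then have "[e * e = e] (mod ?N)"
      using cop by (intro coprime_cong_prod_nat) auto
    moreover have "idem_support q A e = S"
    proof -
      have "q i dvd e \<longleftrightarrow> i \<notin> S" if "i \<in> A" for i
        using e(2)[OF that] primepow_gt_Suc_0[OF pp[OF that]]
        by (auto simp: cong_0_iff cong_dvd_iff split: if_splits)
      then show ?thesis using \<open>S \<subseteq> A\<close> by (auto simp: idem_support_def)
    qed
    ultimately show ?thesis using e(1) by blast
  qed
  ultimately show ?thesis by (auto simp: bij_betw_def idem_support_def)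
qed

lemma prod_dvd_mult_iff_idem_support_disjoint:
  assumes e: "[e * e = e] (mod (\<Prod>i\<in>A. q i))" and f: "[f * f = f] (mod (\<Prod>i\<in>A. q i))"
  shows "(\<Prod>i\<in>A. q i) dvd e * f \<longleftrightarrow> idem_support q A e \<inter> idem_support q A f = {}"
proof -
  have *: "q i dvd e * f \<longleftrightarrow> \<not> (i \<in> idem_support q A e \<and> i \<in> idem_support q A f)"
    if "i \<in> A" for i
  proof -
    have "[e * f = (if i \<in> idem_support q A e then 1 else 0) *
        (if i \<in> idem_support q A f then 1 else 0)] (mod q i)"
      by (intro cong_mult cong_support e f that)
    then show ?thesis
      using primepow_gt_Suc_0[OF pp[OF that]] by (auto simp: cong_dvd_iff split: if_splits)
  qed
  have "(\<Prod>i\<in>A. q i) dvd e * f \<longleftrightarrow> (\<forall>i\<in>A. q i dvd e * f)"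
  proof
    assume "\<forall>i\<in>A. q i dvd e * f"
    then have "[e * f = 0] (mod (\<Prod>i\<in>A. q i))"
      using cop by (intro coprime_cong_prod_nat) (auto simp: cong_0_iff)
    then show "(\<Prod>i\<in>A. q i) dvd e * f" by (simp add: cong_0_iff)
  next
    assume "(\<Prod>i\<in>A. q i) dvd e * f"
    then show "\<forall>i\<in>A. q i dvd e * f" using dvd_trans[OF dvd_prodI[OF fin]] by blast
  qed
  then show ?thesis using * by (auto simp: idem_support_def)
qed

end

section \<open>Counting square roots of one\<close>

text \<open>
  Restricting to totatives costs no solutions, since a square root of \<open>1\<close> is its own
  inverse. It makes the known bijection between totatives of a product and pairs of totatives
  applicable.
\<close>

definition square_roots_of_one :: "nat \<Rightarrow> nat set" where
  "square_roots_of_one m = {x \<in> totatives m. [x * x = 1] (mod m)}"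

lemma card_square_roots_of_one_mult:
  assumes "1 < m" "1 < n" "coprime m n"
  shows "card (square_roots_of_one (m * n)) =
    card (square_roots_of_one m) * card (square_roots_of_one n)"
proof -
  let ?h = "\<lambda>x. (x mod m, x mod n)"
  have bij: "bij_betw ?h (totatives (m * n)) (totatives m \<times> totatives n)"
    by (rule bij_betw_totatives[OF assms])
  have root: "[x * x = 1] (mod (m * n)) \<longleftrightarrow>
      [(x mod m) * (x mod m) = 1] (mod m) \<and> [(x mod n) * (x mod n) = 1] (mod n)" for x
  proof -
    have "[x * x = 1] (mod (m * n)) \<longleftrightarrow> [x * x = 1] (mod m) \<and> [x * x = 1] (mod n)"
      using assms(3) by (metis coprime_cong_mult_nat cong_modulus_mult_nat mult.commute)
    then show ?thesis by (simp add: cong_def mod_mult_eq)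
  qed
  have "bij_betw ?h (square_roots_of_one (m * n))
    (square_roots_of_one m \<times> square_roots_of_one n)"
    unfolding bij_betw_def
  proof
    show "inj_on ?h (square_roots_of_one (m * n))"
      using bij by (auto simp: bij_betw_def square_roots_of_one_def intro: inj_on_subset)
    have "?h ` square_roots_of_one (m * n) =
      {y \<in> ?h ` totatives (m * n). [fst y * fst y = 1] (mod m) \<and> [snd y * snd y = 1] (mod n)}"
      using root by (auto simp: square_roots_of_one_def)
    also have "\<dots> = square_roots_of_one m \<times> square_roots_of_one n"
      using bij by (auto simp: bij_betw_def square_roots_of_one_def)
    finally show "?h ` square_roots_of_one (m * n) =
      square_roots_of_one m \<times> square_roots_of_one n" .
  qed
  then show ?thesis by (metis bij_betw_same_card card_cartesian_product)
qed

lemma square_roots_of_one_iff: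
  assumes "1 < m"
  shows "x \<in> square_roots_of_one m \<longleftrightarrow> x < m \<and> int m dvd (int x - 1) * (int x + 1)"
proof -
  have "[x * x = 1] (mod m) \<longleftrightarrow> int m dvd (int x - 1) * (int x + 1)"
  proof -
    have "[x * x = 1] (mod m) \<longleftrightarrow> [int x * int x = 1] (mod int m)"
      by (metis cong_int_iff of_nat_1 of_nat_mult)
    then show ?thesis by (simp add: cong_iff_dvd_diff algebra_simps)
  qed
  moreover have "x \<in> totatives m" if "x < m" "[x * x = 1] (mod m)"
  proof -
    have "coprime x m" using that(2) coprime_iff_invertible_nat by auto
    moreover have "x > 0" using that(2) assms by (intro Nat.gr0I) (auto simp: cong_def)
    ultimately show ?thesis using that(1) by (simp add: in_totatives_iff)
  qed
  ultimately show ?thesis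
    using totatives_less[OF _ assms] by (auto simp: square_roots_of_one_def)
qed

text \<open>
  An odd prime cannot divide both \<open>x - 1\<close> and \<open>x + 1\<close>, which differ by \<open>2\<close>. So the whole prime
  power divides one of them, and \<open>x\<close> is \<open>1\<close> or \<open>-1\<close>.
\<close>

lemma card_square_roots_of_one_odd_prime_power:
  fixes p :: nat
  assumes "prime p" "p \<noteq> 2" "k > 0"
  shows "card (square_roots_of_one (p ^ k)) = 2"
proof -
  let ?q = "p ^ k"
  have p3: "p > 2" using assms prime_ge_2_nat[of p] by linarith
  then have q3: "?q > 2" using assms(3) self_le_power[of p k] by linarith
  have "square_roots_of_one ?q = {1, ?q - 1}"
  proof (intro equalityI subsetI)
    fix x assume x: "x \<in> square_roots_of_one ?q"
    then have lt: "x < ?q" and dvd: "int p ^ k dvd (int x - 1) * (int x + 1)"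
      using q3 by (auto simp: square_roots_of_one_iff)
    have "int p ^ k dvd int x - 1 \<or> int p ^ k dvd int x + 1"
    proof (cases "int p dvd int x - 1")
      case True
      have "\<not> int p dvd int x + 1"
      proof
        assume "int p dvd int x + 1"
        then have "int p dvd (int x + 1) - (int x - 1)" using True by (rule dvd_diff)
        then have "int p dvd 2" by simp
        then show False using p3 by (auto dest: zdvd_imp_le)
      qed
      then have "coprime (int p ^ k) (int x + 1)"
        using assms(1) by (simp add: prime_imp_coprime)
      then show ?thesis using dvd by (simp add: coprime_dvd_mult_left_iff)
    next
      case False
      then have "coprime (int p ^ k) (int x - 1)"
        using assms(1) by (simp add: prime_imp_coprime)
      then show ?thesis using dvd by (simp add: coprime_dvd_mult_right_iff)
    qed
    then show "x \<in> {1, ?q - 1}"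
    proof
      assume "int p ^ k dvd int x - 1"
      then have d: "int ?q dvd int x - 1" by simp
      have "int x - 1 = 0"
      proof (rule ccontr)
        assume "int x - 1 \<noteq> 0"
        from dvd_imp_le_int[OF this d] show False using lt q3 by linarith
      qed
      then show ?thesis by simp
    next
      assume "int p ^ k dvd int x + 1"
      then have "int ?q dvd int (x + 1)" by (simp add: add.commute)
      then have "?q dvd x + 1" by (simp only: int_dvd_int_iff)
      then have "?q \<le> x + 1" by (rule dvd_imp_le) simp
      then have "x = ?q - 1" using lt by linarith
      then show ?thesis by simp
    qed
  next
    fix x assume x: "x \<in> {1, ?q - 1}"
    then consider "x = 1" | "x = ?q - 1" by blast
    then have "int ?q dvd (int x - 1) * (int x + 1)"
    proof cases
      case 2
      then have "x + 1 = ?q" using q3 by linarith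
      then have "int x + 1 = int ?q" by linarith
      then show ?thesis by (metis dvd_triv_right)
    qed simp
    moreover have "x < ?q" using x q3 by auto
    ultimately show "x \<in> square_roots_of_one ?q"
      using square_roots_of_one_iff[of ?q x] q3 by linarith
  qed
  then show ?thesis using q3 by simp
qed

lemma card_square_roots_of_one_2: "card (square_roots_of_one 2) = 1"
proof -
  have "square_roots_of_one 2 = {1}"
    by (auto simp: square_roots_of_one_iff less_2_cases_iff)
  then show ?thesis by simp
qed

lemma card_square_roots_of_one_4: "card (square_roots_of_one 4) = 2"
proof -
  have "x \<in> square_roots_of_one 4 \<longleftrightarrow> x = 1 \<or> x = 3" for x
  proof
    assume x: "x \<in> square_roots_of_one 4"
    then have "x < 4" by (simp add: square_roots_of_one_iff)
    then consider "x = 0" | "x = 1" | "x = 2" | "x = 3" by linarith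
    then show "x = 1 \<or> x = 3" using x by cases (simp_all add: square_roots_of_one_iff)
  qed (auto simp: square_roots_of_one_iff)
  then have "square_roots_of_one 4 = {1, 3}" by blast
  then show ?thesis by simp
qed

text \<open>
  For odd \<open>x = 2 y + 1\<close> the product \<open>(x - 1) (x + 1)\<close> equals \<open>4 y (y + 1)\<close>, and \<open>y\<close> and \<open>y + 1\<close>
  are coprime. So with \<open>2\<^sup>k = 4 h\<close> the number \<open>h\<close>, again a power of \<open>2\<close>, divides one of them. This
  leaves the four solutions \<open>\<plusminus>1\<close> and \<open>2 h \<plusminus> 1\<close>, which are distinct because \<open>h \<ge> 2\<close>.
\<close>

lemma card_square_roots_of_one_power_of_2:
  assumes "k \<ge> 3"
  shows "card (square_roots_of_one (2 ^ k)) = 4"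
proof -
  define j where "j = k - 3"
  define h :: nat where "h = 2 ^ Suc j"
  have "k = Suc (Suc (Suc j))" using assms by (simp add: j_def)
  then have q: "2 ^ k = 4 * h" by (simp add: h_def)
  have h: "h \<ge> 2" by (simp add: h_def)
  have "square_roots_of_one (4 * h) = {1, 2 * h - 1, 2 * h + 1, 4 * h - 1}"
  proof (intro equalityI subsetI)
    fix x assume "x \<in> square_roots_of_one (4 * h)"
    then have lt: "x < 4 * h" and dvd: "4 * int h dvd (int x - 1) * (int x + 1)"
      using h by (auto simp: square_roots_of_one_iff)
    have "odd x"
    proof
      assume "even x"
      then have "odd ((int x - 1) * (int x + 1))" by simp
      moreover have "even (4 * int h)" by simp
      ultimately show False using dvd dvd_trans by blast
    qed
    then obtain y where y: "x = 2 * y + 1" by (auto elim: oddE)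
    then have "4 * int h dvd 4 * (int y * (int y + 1))"
      using dvd by (simp add: algebra_simps)
    then have "int h dvd int y * (int y + 1)" by (subst (asm) dvd_mult_cancel_left) simp
    then have "2 ^ Suc j dvd int y * (int y + 1)" by (simp add: h_def)
    then have "2 ^ Suc j dvd int y \<or> 2 ^ Suc j dvd int y + 1"
      by (intro prime_power_dvd_coprime_mult) auto
    then have "int h dvd int y \<or> int h dvd int (y + 1)" by (simp add: h_def add.commute)
    then have "h dvd y \<or> h dvd y + 1" by (simp only: int_dvd_int_iff)
    then show "x \<in> {1, 2 * h - 1, 2 * h + 1, 4 * h - 1}"
    proof
      assume "h dvd y"
      then obtain c where c: "y = h * c" by (elim dvdE)
      then have "h * c < h * 2" using lt y by linarith
      then have "c < 2" by simp
      then show ?thesis using y c by (auto simp: less_2_cases_iff)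
    next
      assume "h dvd y + 1"
      then obtain c where c: "y + 1 = h * c" by (elim dvdE)
      then have "h * c \<le> h * 2" "h * c > 0" using lt y by linarith+
      then have "c = 1 \<or> c = 2" using h by auto
      then show ?thesis using y c by auto
    qed
  next
    fix x assume "x \<in> {1, 2 * h - 1, 2 * h + 1, 4 * h - 1}"
    then have x: "x = 1 \<or> x = 2 * h - 1 \<or> x = 2 * h + 1 \<or> x = 4 * h - 1" by simp
    then consider "x = 1" | "x = 2 * h - 1" | "x = 2 * h + 1" | "x = 4 * h - 1" by blast
    then have "4 * int h dvd (int x - 1) * (int x + 1)"
    proof cases
      case 2
      then have "(int x - 1) * (int x + 1) = 4 * int h * (int h - 1)"
        using h by (simp add: of_nat_diff algebra_simps)
      then show ?thesis by simp
    next
      case 3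
      then have "(int x - 1) * (int x + 1) = 4 * int h * (int h + 1)"
        by (simp add: algebra_simps)
      then show ?thesis by simp
    next
      case 4
      then have "int x + 1 = 4 * int h" using h by simp
      then show ?thesis by simp
    qed simp
    moreover have "x < 4 * h" using x h by linarith
    ultimately show "x \<in> square_roots_of_one (4 * h)"
      using h by (simp add: square_roots_of_one_iff)
  qed
  moreover have "card {1, 2 * h - 1, 2 * h + 1, 4 * h - 1} = 4"
  proof -
    obtain g where "h = 2 + g" using le_Suc_ex[OF h] by blast
    then show ?thesis by (simp add: card_insert_if)
  qed
  ultimately show ?thesis by (simp add: q)
qed

section \<open>Clean graphs of residue rings\<close>

text \<open>
  The residue ring lives on integers, while remainders, totatives and divisibility were treated on
  natural numbers; this translates between the two.
\<close>

lemma residue_ring_nat_image: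
  fixes N :: nat
  assumes N: "N > 1"
  defines "R \<equiv> residue_ring (int N)"
  shows "idempotents R = int ` {e. e < N \<and> [e * e = e] (mod N)}"
    and "Units R = int ` totatives N"
    and "{u \<in> Units R. u \<otimes>\<^bsub>R\<^esub> u = \<one>\<^bsub>R\<^esub>} = int ` square_roots_of_one N"
    and "int e \<otimes>\<^bsub>R\<^esub> int f = \<zero>\<^bsub>R\<^esub> \<longleftrightarrow> N dvd e * f"
proof -
  interpret residues "int N" R
  proof -
    show "residues (int N)" by unfold_locales (use N in simp)
    show "R \<equiv> residue_ring (int N)" by (rule eq_reflection) (simp add: R_def)
  qed
  have sq: "int x \<otimes>\<^bsub>R\<^esub> int y = int (x * y mod N)" for x y
    by (simp add: res_mult_eq zmod_int)
  have carrier: "carrier R = int ` {0..<N}"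
    unfolding res_carrier_eq image_int_atLeastLessThan by auto
  show "idempotents R = int ` {e. e < N \<and> [e * e = e] (mod N)}"
    by (auto simp: idempotents_def carrier sq cong_def)
  show units: "Units R = int ` totatives N"
  proof (intro equalityI subsetI)
    fix u assume "u \<in> Units R"
    then have "0 < u" "u < int N" "coprime u (int N)" by (auto simp: res_units_eq)
    then have "nat u \<in> totatives N" "u = int (nat u)"
      by (auto simp: in_totatives_iff coprime_int_iff[symmetric] simp del: coprime_int_iff)
    then show "u \<in> int ` totatives N" by blast
  next
    fix u assume "u \<in> int ` totatives N"
    then show "u \<in> Units R"
      using totatives_less[OF _ N] by (auto simp: res_units_eq in_totatives_iff)
  qed
  show "{u \<in> Units R. u \<otimes>\<^bsub>R\<^esub> u = \<one>\<^bsub>R\<^esub>} = int ` square_roots_of_one N"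
    using N by (auto simp: units square_roots_of_one_def sq res_one_eq cong_def)
  show "int e \<otimes>\<^bsub>R\<^esub> int f = \<zero>\<^bsub>R\<^esub> \<longleftrightarrow> N dvd e * f"
    unfolding sq res_zero_eq by (simp add: mod_eq_0_iff_dvd flip: of_nat_mod)
qed

text \<open>
  The base graph may be any graph whose vertices can be labelled by the nonempty proper subsets of
  the index set of the prime powers so that adjacency means disjointness. The full index set is the
  label of the additional vertex \<open>z\<close>, being the support of the idempotent \<open>1\<close>.
\<close>

lemma clean_graph2_residue_ring_iso_shuriken:
  fixes q :: "'i \<Rightarrow> nat" and lab :: "'v \<Rightarrow> 'i set"
  assumes fin: "finite A" and ne: "A \<noteq> {}" and pp: "\<And>i. i \<in> A \<Longrightarrow> primepow (q i)"
    and cop: "\<And>i j. i \<in> A \<Longrightarrow> j \<in> A \<Longrightarrow> i \<noteq> j \<Longrightarrow> coprime (q i) (q j)"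
    and G: "pair_graph G"
    and lab: "bij_betw lab (pverts G) (Pow A - {{}, A})"
    and adj: "\<And>x y. x \<in> pverts G \<Longrightarrow> y \<in> pverts G \<Longrightarrow> (x, y) \<in> parcs G \<longleftrightarrow> lab x \<inter> lab y = {}"
  defines "N \<equiv> \<Prod>i\<in>A. q i"
  shows "digraph_iso (with_proj (clean_graph2 (residue_ring (int N))))
    (with_proj (shuriken (card (square_roots_of_one N)) (totient N) G))"
proof -
  define R where "R = residue_ring (int N)"
  obtain i where i: "i \<in> A" using ne by blast
  have "q i dvd N" unfolding N_def by (rule dvd_prodI[OF fin i])
  moreover have "N > 0" unfolding N_def using pp by (intro prod_pos) (auto simp: primepow_gt_0_nat)
  ultimately have N: "N > 1" using primepow_gt_Suc_0[OF pp[OF i]] dvd_imp_le[of "q i" N] by simp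
  interpret residues "int N" R
  proof -
    show "residues (int N)" by unfold_locales (use N in simp)
    show "R \<equiv> residue_ring (int N)" by (rule eq_reflection) (simp add: R_def)
  qed
  note R = residue_ring_nat_image[OF N, folded R_def]
  let ?S = "idem_support q A" and ?X = "{e. e < N \<and> [e * e = e] (mod N)}"
  let ?V = "insert None (Some ` pverts G)"
  define label where "label = case_option A lab"
  have label: "bij_betw label ?V (Pow A - {{}})"
  proof -
    have "bij_betw label (Some ` pverts G) (Pow A - {{}, A})"
      using lab by (auto simp: bij_betw_def label_def inj_on_def image_image)
    moreover have "Pow A - {{}} = insert A (Pow A - {{}, A})" using ne by auto
    moreover have "label None = A" by (simp add: label_def)
    ultimately show ?thesis
      using notIn_Un_bij_betw[of None "Some ` pverts G" label "Pow A - {{}, A}"] by auto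
  qed
  have support: "bij_betw ?S (?X - {0}) (Pow A - {{}})"
  proof -
    have S: "bij_betw ?S ?X (Pow A)"
      using bij_betw_idem_support[OF fin pp cop] by (simp add: N_def)
    have zero: "0 \<in> ?X" "?S 0 = {}" using N by (simp_all add: idem_support_def)
    have "?S ` (?X - {0}) = ?S ` ?X - ?S ` {0}"
      using zero by (intro inj_on_image_set_diff[OF bij_betw_imp_inj_on[OF S]]) auto
    also have "\<dots> = Pow A - {{}}" using bij_betw_imp_surj_on[OF S] zero by simp
    finally show ?thesis by (intro bij_betw_subset[OF S]) auto
  qed
  have I: "idempotents R - {\<zero>\<^bsub>R\<^esub>} = int ` (?X - {0})"
    by (auto simp: R(1) res_zero_eq)
  define \<phi> where "\<phi> = inv_into ?V label \<circ> (?S \<circ> nat)"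
  have "bij_betw nat (int ` (?X - {0})) (?X - {0})"
    by (rule bij_betwI[where g = int]) auto
  then have \<phi>: "bij_betw \<phi> (idempotents R - {\<zero>\<^bsub>R\<^esub>}) ?V"
    unfolding \<phi>_def I
    by (intro bij_betw_trans[OF bij_betw_trans[OF _ support] bij_betw_inv_into[OF label]])
  have label_\<phi>: "label (\<phi> e) = ?S (nat e)" if e: "e \<in> idempotents R - {\<zero>\<^bsub>R\<^esub>}" for e
  proof -
    obtain a where "e = int a" "a \<in> ?X - {0}" using e unfolding I by blast
    then have "?S (nat e) \<in> Pow A - {{}}" using bij_betwE[OF support] by simp
    then have "?S (nat e) \<in> label ` ?V" unfolding bij_betw_imp_surj_on[OF label] .
    then show ?thesis unfolding \<phi>_def by (simp add: f_inv_into_f)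
  qed
  have disjoint: "label x \<inter> label y = {} \<longleftrightarrow>
      (\<exists>u v. x = Some u \<and> y = Some v \<and> (u, v) \<in> parcs G)"
    if "x \<in> ?V" "y \<in> ?V" for x y
  proof -
    have "lab u \<noteq> {}" "lab u \<subseteq> A" if "u \<in> pverts G" for u
      using bij_betwE[OF lab] that by auto
    then show ?thesis using that ne by (auto simp: label_def adj Int_absorb1 Int_absorb2)
  qed
  have "digraph_iso (with_proj (clean_graph2 R))
    (with_proj (shuriken (card {u \<in> Units R. u \<otimes>\<^bsub>R\<^esub> u = \<one>\<^bsub>R\<^esub>}) (card (Units R)) G))"
  proof (rule clean_graph2_iso_shuriken[OF cring finite_Units G \<phi>])
    fix e f assume e: "e \<in> idempotents R - {\<zero>\<^bsub>R\<^esub>}" and f: "f \<in> idempotents R - {\<zero>\<^bsub>R\<^esub>}"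
    then obtain a b where a: "e = int a" "[a * a = a] (mod N)" and b: "f = int b" "[b * b = b] (mod N)"
      unfolding I by auto
    have "e \<otimes>\<^bsub>R\<^esub> f = \<zero>\<^bsub>R\<^esub> \<longleftrightarrow> ?S a \<inter> ?S b = {}"
      unfolding a(1) b(1) R(4)
      using prod_dvd_mult_iff_idem_support_disjoint[OF fin pp cop] a(2) b(2) by (simp add: N_def)
    also have "\<dots> \<longleftrightarrow> label (\<phi> e) \<inter> label (\<phi> f) = {}"
      using label_\<phi>[OF e] label_\<phi>[OF f] a(1) b(1) by simp
    also have "\<dots> \<longleftrightarrow> (\<exists>x y. \<phi> e = Some x \<and> \<phi> f = Some y \<and> (x, y) \<in> parcs G)"
      using bij_betwE[OF \<phi>] e f by (intro disjoint) blast+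
    finally show "e \<otimes>\<^bsub>R\<^esub> f = \<zero>\<^bsub>R\<^esub> \<longleftrightarrow>
      (\<exists>x y. \<phi> e = Some x \<and> \<phi> f = Some y \<and> (x, y) \<in> parcs G)" .
  qed
  moreover have "card (Units R) = totient N"
    by (simp add: R(2) card_image totient_def)
  moreover have "card {u \<in> Units R. u \<otimes>\<^bsub>R\<^esub> u = \<one>\<^bsub>R\<^esub>} = card (square_roots_of_one N)"
    by (simp add: R(3) card_image)
  ultimately show ?thesis by (simp add: R_def)
qed

section \<open>The case of four prime powers\<close>

text \<open>
  The labels are forced by the edges of \<open>G\<^sub>2\<close> once its clique \<open>a, b, c, d\<close> is taken as the four
  singletons: a vertex joined to two of these is the complementary pair, and the pendant vertices
  \<open>k, l, m, n\<close> are the complements of the singletons \<open>a, b, c, d\<close> that they are joined to.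
\<close>

fun subset_label :: "g2_vertex \<Rightarrow> nat set" where
  "subset_label Va = {0}" | "subset_label Vb = {1}"
| "subset_label Vc = {2}" | "subset_label Vd = {3}"
| "subset_label Ve = {2, 3}" | "subset_label Vh = {0, 1}"
| "subset_label Vf = {1, 2}" | "subset_label Vg = {0, 3}"
| "subset_label Vi = {1, 3}" | "subset_label Vj = {0, 2}"
| "subset_label Vk = {1, 2, 3}" | "subset_label Vl = {0, 2, 3}"
| "subset_label Vm = {0, 1, 3}" | "subset_label Vn = {0, 1, 2}"

lemma arcs_graph_G2_iff_disjoint: "(x, y) \<in> parcs graph_G2 \<longleftrightarrow> subset_label x \<inter> subset_label y = {}"
  by (cases x; cases y; simp add: graph_G2_def arcs_mk_symmetric_iff)

lemma bij_betw_subset_label: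
  "bij_betw subset_label (pverts graph_G2) (Pow {..<4} - {{}, {..<4}})"
proof -
  have four: "{..<4} = {0, 1, 2, 3 :: nat}" by auto
  \<comment> \<open>Injectivity suffices, as there are as many vertices as nonempty proper subsets.\<close>
  have "inj subset_label"
  proof (rule injI)
    have mem: "i \<in> subset_label x \<longleftrightarrow> i \<in> subset_label y" if "subset_label x = subset_label y" for i x y
      using that by simp
    fix x y assume eq: "subset_label x = subset_label y"
    show "x = y"
      using mem[OF eq, of 0] mem[OF eq, of 1] mem[OF eq, of 2] mem[OF eq, of 3]
      by (cases x; cases y; simp)
  qed
  then have inj: "inj_on subset_label (pverts graph_G2)" by (rule inj_on_subset) simp
  have "subset_label x \<subseteq> {..<4} \<and> subset_label x \<noteq> {} \<and> (\<exists>i\<in>{..<4}. i \<notin> subset_label x)" for x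
    unfolding four by (cases x) simp_all
  then have sub: "subset_label ` pverts graph_G2 \<subseteq> Pow {..<4} - {{}, {..<4}}" by blast
  have "card {{}, {..<4 :: nat}} = 2" by (simp add: four)
  then have "card (Pow {..<4 :: nat} - {{}, {..<4}}) = 2 ^ 4 - 2"
    by (subst card_Diff_subset) (simp_all add: card_Pow)
  then have "subset_label ` pverts graph_G2 = Pow {..<4} - {{}, {..<4}}"
    using sub by (intro card_subset_eq) (simp_all add: card_image[OF inj] card_graph_G2)
  then show ?thesis using inj by (simp add: bij_betw_def)
qed

lemma totient_prime_power_diff:
  assumes "prime (p::nat)" "k \<ge> 1"
  shows "totient (p ^ k) = p ^ k - p ^ (k - 1)"
proof -
  obtain j where k: "k = Suc j" using assms(2) by (cases k) auto
  show ?thesis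
    unfolding k totient_prime_power_Suc[OF assms(1)]
    by (simp add: diff_mult_distrib diff_mult_distrib2 mult.commute)
qed

theorem proposition4:
  fixes p1 p2 p3 p4 n1 n2 n3 n4 :: nat
  assumes "prime p1" and "prime p2" and "prime p3" and "prime p4"
    and "distinct [p1, p2, p3, p4]"
    and "n1 \<ge> 1" and "n2 \<ge> 1" and "n3 \<ge> 1" and "n4 \<ge> 1"
  shows
    "let N = p1 ^ n1 * p2 ^ n2 * p3 ^ n3 * p4 ^ n4;
         M = (p2 ^ n2 - p2 ^ (n2 - 1)) * (p3 ^ n3 - p3 ^ (n3 - 1)) * (p4 ^ n4 - p4 ^ (n4 - 1));
         Cl2 = with_proj (clean_graph2 (residue_ring (int N)));
         Shu = (\<lambda>t n. with_proj (shuriken t n graph_G2))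
     in (p1 ^ n1 = 2 \<longrightarrow> digraph_iso Cl2 (Shu 8 M)) \<and>
        (p1 ^ n1 = 4 \<longrightarrow> digraph_iso Cl2 (Shu 16 (2 * M))) \<and>
        (p1 = 2 \<and> n1 \<ge> 3 \<longrightarrow> digraph_iso Cl2 (Shu 32 ((p1 ^ n1 - p1 ^ (n1 - 1)) * M))) \<and>
        (p1 \<noteq> 2 \<and> p2 \<noteq> 2 \<and> p3 \<noteq> 2 \<and> p4 \<noteq> 2 \<longrightarrow>
           digraph_iso Cl2 (Shu 16 ((p1 ^ n1 - p1 ^ (n1 - 1)) * M)))"
proof -
  define q1 q2 q3 q4 where q: "q1 = p1 ^ n1" "q2 = p2 ^ n2" "q3 = p3 ^ n3" "q4 = p4 ^ n4"
  define N where "N = q1 * q2 * q3 * q4"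
  define M where "M = (q2 - p2 ^ (n2 - 1)) * (q3 - p3 ^ (n3 - 1)) * (q4 - p4 ^ (n4 - 1))"
  have pp: "primepow q1" "primepow q2" "primepow q3" "primepow q4"
    using assms by (auto simp: q intro!: primepow_prime_power)
  have gt1: "q1 > 1" "q2 > 1" "q3 > 1" "q4 > 1"
    using pp[THEN primepow_gt_Suc_0] by simp_all
  have cop: "coprime q1 q2" "coprime q1 q3" "coprime q1 q4"
    "coprime q2 q3" "coprime q2 q4" "coprime q3 q4"
    using assms by (simp_all add: q primes_coprime)
  have cop': "coprime (q1 * q2) q3" "coprime (q1 * q2 * q3) q4"
    using cop by simp_all
  have gt1': "q1 * q2 > 1" "q1 * q2 * q3 > 1"
    by (intro less_1_mult gt1)+
  have "totient q1 = q1 - p1 ^ (n1 - 1)" "totient q2 = q2 - p2 ^ (n2 - 1)"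
    "totient q3 = q3 - p3 ^ (n3 - 1)" "totient q4 = q4 - p4 ^ (n4 - 1)"
    unfolding q using assms by (blast intro: totient_prime_power_diff)+
  then have totient: "totient N = (q1 - p1 ^ (n1 - 1)) * M"
    by (simp add: N_def M_def totient_mult_coprime cop cop' mult.assoc)
  have roots: "card (square_roots_of_one N) = card (square_roots_of_one q1) *
      card (square_roots_of_one q2) * card (square_roots_of_one q3) * card (square_roots_of_one q4)"
    unfolding N_def by (simp only: card_square_roots_of_one_mult gt1 gt1' cop cop')
  let ?q = "\<lambda>i. [q1, q2, q3, q4] ! i"
  have four: "{..<4} = {0, 1, 2, 3 :: nat}" by auto
  have prod: "(\<Prod>i<4. ?q i) = N" by (simp add: four N_def)
  have iso: "digraph_iso (with_proj (clean_graph2 (residue_ring (int N))))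
    (with_proj (shuriken (card (square_roots_of_one N)) (totient N) graph_G2))"
  proof (rule clean_graph2_residue_ring_iso_shuriken[of "{..<4}" ?q graph_G2 subset_label, unfolded prod])
    show "primepow (?q i)" if "i \<in> {..<4}" for i
      using that pp by (auto simp: four)
    show "coprime (?q i) (?q j)" if "i \<in> {..<4}" "j \<in> {..<4}" "i \<noteq> j" for i j
      using that cop by (auto simp: four coprime_commute)
    show "{..<4 :: nat} \<noteq> {}" by (simp add: four)
  qed (auto simp: pair_graph_G2 bij_betw_subset_label arcs_graph_G2_iff_disjoint)
  have odd_roots: "card (square_roots_of_one q2) = 2 \<and> card (square_roots_of_one q3) = 2 \<and>
      card (square_roots_of_one q4) = 2" if "p2 \<noteq> 2" "p3 \<noteq> 2" "p4 \<noteq> 2"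
    using that assms by (simp add: q card_square_roots_of_one_odd_prime_power)
  have base_2: "p1 = 2" if "even q1"
    using that primes_dvd_imp_eq[OF two_is_prime_nat assms(1)] by (simp add: q)
  have n1_eq_1: "n1 = 1" if "q1 = 2"
    using that base_2 power_inject_exp[of "2::nat" n1 1] by (simp add: q)
  have n1_eq_2: "n1 = 2" if "q1 = 4"
    using that base_2 power_inject_exp[of "2::nat" n1 2] by (simp add: q)
  have "digraph_iso (with_proj (clean_graph2 (residue_ring (int N)))) (with_proj (shuriken 8 M graph_G2))"
    if "q1 = 2"
  proof -
    have "p2 \<noteq> 2" "p3 \<noteq> 2" "p4 \<noteq> 2" using base_2 that assms by auto
    then have "card (square_roots_of_one N) = 8"
      using odd_roots by (simp add: roots that card_square_roots_of_one_2)
    moreover have "totient N = M" using that n1_eq_1 base_2 by (simp add: totient)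
    ultimately show ?thesis using iso by simp
  qed
  moreover have "digraph_iso (with_proj (clean_graph2 (residue_ring (int N))))
      (with_proj (shuriken 16 (2 * M) graph_G2))" if "q1 = 4"
  proof -
    have "p2 \<noteq> 2" "p3 \<noteq> 2" "p4 \<noteq> 2" using base_2 that assms by auto
    then have "card (square_roots_of_one N) = 16"
      using odd_roots by (simp add: roots that card_square_roots_of_one_4)
    moreover have "totient N = 2 * M" using that n1_eq_2 base_2 by (simp add: totient)
    ultimately show ?thesis using iso by simp
  qed
  moreover have "digraph_iso (with_proj (clean_graph2 (residue_ring (int N))))
      (with_proj (shuriken 32 ((q1 - p1 ^ (n1 - 1)) * M) graph_G2))" if "p1 = 2" "n1 \<ge> 3"
  proof -
    have "p2 \<noteq> 2" "p3 \<noteq> 2" "p4 \<noteq> 2" using that assms by auto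
    then have "card (square_roots_of_one N) = 32"
      using odd_roots that by (simp add: roots q(1) card_square_roots_of_one_power_of_2)
    then show ?thesis using iso by (simp add: totient)
  qed
  moreover have "digraph_iso (with_proj (clean_graph2 (residue_ring (int N))))
      (with_proj (shuriken 16 ((q1 - p1 ^ (n1 - 1)) * M) graph_G2))"
    if "p1 \<noteq> 2" "p2 \<noteq> 2" "p3 \<noteq> 2" "p4 \<noteq> 2"
  proof -
    have "card (square_roots_of_one q1) = 2"
      using that assms by (simp add: q card_square_roots_of_one_odd_prime_power)
    then have "card (square_roots_of_one N) = 16" using odd_roots that by (simp add: roots)
    then show ?thesis using iso by (simp add: totient)
  qed
  ultimately show ?thesis unfolding N_def M_def q Let_def by blast
qed

end
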